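(* Let $A_{0},A_{1},B_{0},B_{1},E,F$ be non-trivial Banach spaces such that $A_{0},A_{1},B_{0},B_{1}\hookrightarrow E$, and consider a bounded linear operator $T:E\rightarrow F$. Assume that $A_{0}$ and $A_{1}$ have separable preduals and that $E$ is separable and reflexive. Suppose moreover that (i) $A_{1}\hookrightarrow A_{0}$, $B_{0}\hookrightarrow A_{0}$ and $A_{0}\cap B_{1}\hookrightarrow A_{1}$; (ii) $T(B_{1})\hookrightarrow T(A_{1})$. Then, for any $\theta\in(0,1)$ and any $q\in[1,\infty)$, we have $$T((B_{0},B_{1})_{\theta,q})\hookrightarrow T((A_{0},A_{1})_{\theta,q}).$$
   Context: $(A_0,A_1)_{\theta,q}$ denotes the usual real interpolation space (e.g. by the $K$-method), and $\hookrightarrow$ between spaces denotes continuous embedding. Embeddings of images: if $A,B,F$ are Banach spaces and $T_1:A\to F$, $T_2:B\to F$ are linear operators, one writes $T_2(B)\hookrightarrow T_1(A)$ if there exists a constant $C>0$ such that for any $b\in B$ there exists $a\in A$ with $T_1a=T_2b$ in $F$ and $\|a\|_A\le C\|b\|_B$. Here $T$ is restricted to the respective subspaces of $E$, each with its own norm. *)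

theory Defs
  imports "HOL-Analysis.Analysis"
begin

text \<open>
  Continuously embedded spaces, their intersections and their interpolation spaces are all
  linear subspaces of one ambient space, each carrying its own norm. The field
  \<open>nrm\<close> is only meaningful on \<open>pts\<close>.
\<close>

record 'e nspace =
  pts :: "'e set"
  nrm :: "'e \<Rightarrow> real"

text \<open>For injective \<open>j\<close>: the domain of \<open>j\<close>, viewed as a subspace of the codomain.\<close>

definition embedded :: "('a::real_normed_vector \<Rightarrow> 'e::real_normed_vector) \<Rightarrow> 'e nspace" where
  "embedded j = \<lparr>pts = range j, nrm = (\<lambda>x. norm (inv j x))\<rparr>"

definition continuous_embedding :: "('a::real_normed_vector \<Rightarrow> 'e::real_normed_vector) \<Rightarrow> bool" where
  "continuous_embedding j \<longleftrightarrow> bounded_linear j \<and> inj j"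

definition inter_space :: "'e nspace \<Rightarrow> 'e nspace \<Rightarrow> 'e nspace" where
  "inter_space X Y = \<lparr>pts = pts X \<inter> pts Y, nrm = (\<lambda>x. max (nrm X x) (nrm Y x))\<rparr>"

definition embeds :: "'e nspace \<Rightarrow> 'e nspace \<Rightarrow> bool" (infix "\<hookrightarrow>" 50) where
  "X \<hookrightarrow> Y \<longleftrightarrow> pts X \<subseteq> pts Y \<and> (\<exists>C>0. \<forall>x\<in>pts X. nrm Y x \<le> C * nrm X x)"

text \<open>\<open>image_embeds T2 B T1 A\<close> means \<open>T2(B) \<hookrightarrow> T1(A)\<close>.\<close>

definition image_embeds ::
    "('b \<Rightarrow> 'f) \<Rightarrow> 'b nspace \<Rightarrow> ('a \<Rightarrow> 'f) \<Rightarrow> 'a nspace \<Rightarrow> bool" where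
  "image_embeds T2 B T1 A \<longleftrightarrow>
     (\<exists>C>0. \<forall>b\<in>pts B. \<exists>a\<in>pts A. T1 a = T2 b \<and> nrm A a \<le> C * nrm B b)"

definition K_functional :: "'e::real_vector nspace \<Rightarrow> 'e nspace \<Rightarrow> real \<Rightarrow> 'e \<Rightarrow> real" where
  "K_functional X Y t x =
     Inf {nrm X y + t * nrm Y z | y z. y \<in> pts X \<and> z \<in> pts Y \<and> x = y + z}"

definition interp_integral ::
    "'e::real_vector nspace \<Rightarrow> 'e nspace \<Rightarrow> real \<Rightarrow> real \<Rightarrow> 'e \<Rightarrow> ennreal" where
  "interp_integral X Y \<theta> q x =
     (\<integral>\<^sup>+t\<in>{0<..}. ennreal ((t powr (-\<theta>) * K_functional X Y t x) powr q / t) \<partial>lborel)"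

text \<open>
  The real interpolation space for \<open>0 < \<theta> < 1\<close> and \<open>1 \<le> q < \<infinity>\<close>. Membership in the
  sum of the two spaces is required explicitly because \<open>K_functional\<close> is an infimum over the
  empty set, hence unspecified, outside of it.
\<close>

definition real_interp :: "'e::real_vector nspace \<Rightarrow> 'e nspace \<Rightarrow> real \<Rightarrow> real \<Rightarrow> 'e nspace" where
  "real_interp X Y \<theta> q =
     \<lparr>pts = {x. (\<exists>y\<in>pts X. \<exists>z\<in>pts Y. x = y + z) \<and> interp_integral X Y \<theta> q x < \<infinity>},
      nrm = (\<lambda>x. enn2real (interp_integral X Y \<theta> q x) powr (1 / q))\<rparr>"

definition nontrivial_space :: "'a::real_normed_vector itself \<Rightarrow> bool" where
  "nontrivial_space _ \<longleftrightarrow> (\<exists>x::'a. x \<noteq> 0)"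

definition separable :: "'a::real_normed_vector itself \<Rightarrow> bool" where
  "separable _ \<longleftrightarrow> separable_space (euclidean :: 'a topology)"

text \<open>Surjectivity of the canonical map into the bidual.\<close>

definition reflexive :: "'a::real_normed_vector itself \<Rightarrow> bool" where
  "reflexive _ \<longleftrightarrow>
     (\<forall>\<Phi> :: ('a \<Rightarrow>\<^sub>L real) \<Rightarrow>\<^sub>L real. \<exists>x::'a. \<forall>f :: 'a \<Rightarrow>\<^sub>L real. blinfun_apply \<Phi> f = blinfun_apply f x)"

text \<open>
  The dual of \<open>'p\<close> is linearly homeomorphic to \<open>'a\<close>. Isometric preduals are a
  special case.
\<close>

definition is_predual :: "'p::banach itself \<Rightarrow> 'a::banach itself \<Rightarrow> bool" where
  "is_predual _ _ \<longleftrightarrow>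
     (\<exists>\<phi> :: ('p \<Rightarrow>\<^sub>L real) \<Rightarrow> 'a. bounded_linear \<phi> \<and> bij \<phi> \<and> bounded_linear (inv \<phi>))"

end

theory Submission
  imports Defs
begin

text \<open>
  Split \<open>b = y\<^sub>1 + z\<^sub>1\<close> almost optimally at \<open>t = 1\<close>, replace \<open>z\<^sub>1\<close> by some \<open>a\<^sub>1 \<in> A\<^sub>1\<close> with
  \<open>T a\<^sub>1 = T z\<^sub>1\<close>, and put \<open>a = y\<^sub>1 + a\<^sub>1\<close>. For every other splitting \<open>b = y + z\<close> the difference
  \<open>w = y\<^sub>1 - y = z - z\<^sub>1\<close> lies in \<open>A\<^sub>0 \<inter> B\<^sub>1\<close>, hence in \<open>A\<^sub>1\<close>, so that \<open>a = y + (w + a\<^sub>1)\<close> is a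
  splitting of \<open>a\<close> which competes in \<open>K(t,a)\<close> for \<open>t \<le> 1\<close>; for \<open>t \<ge> 1\<close> the trivial splitting
  \<open>a = a + 0\<close> is good enough because \<open>A\<^sub>1 \<hookrightarrow> A\<^sub>0\<close>. Together with
  \<open>min 1 t * K(1,b) \<le> K(t,b)\<close> this gives \<open>K(t,a) \<le> C * K(t,b)\<close> for all \<open>t > 0\<close>, with one \<open>a\<close>
  independent of \<open>t\<close>.
\<close>

section \<open>Subspaces of the ambient space with their own norms\<close>

text \<open>The norm properties that the estimates of the K-functional rest on. The last conjunct is
  continuity of the inclusion into the ambient space; it also forces \<open>nrm X x > 0\<close> for
  nonzero \<open>x\<close> in \<open>pts X\<close>.\<close>

definition normed_subspace :: "'e::real_normed_vector nspace \<Rightarrow> bool" where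
  "normed_subspace X \<longleftrightarrow> subspace (pts X) \<and> nrm X 0 = 0 \<and>
     (\<forall>x\<in>pts X. 0 \<le> nrm X x) \<and>
     (\<forall>x\<in>pts X. \<forall>y\<in>pts X. nrm X (x + y) \<le> nrm X x + nrm X y \<and> nrm X (x - y) \<le> nrm X x + nrm X y) \<and>
     (\<exists>M>0. \<forall>x\<in>pts X. norm x \<le> M * nrm X x)"

lemma normed_subspace_embedded:
  assumes "continuous_embedding j"
  shows "normed_subspace (embedded j)"
proof -
  have bl: "bounded_linear j" and inj: "inj j"
    using assms by (auto simp: continuous_embedding_def)
  interpret bounded_linear j by (fact bl)
  have nrm_j: "nrm (embedded j) (j x) = norm x" for x
    by (simp add: embedded_def inj)
  obtain M where M: "M > 0" "\<And>x. norm (j x) \<le> norm x * M"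
    using pos_bounded by blast
  have sub: "subspace (range j)"
    using linear_axioms linear_subspace_image subspace_UNIV by blast
  have "nrm (embedded j) 0 = 0"
    using nrm_j[of 0] by (simp add: zero)
  moreover have "nrm (embedded j) (j x + j y) \<le> norm x + norm y" for x y
    using nrm_j[of "x + y"] by (simp add: add norm_triangle_ineq)
  moreover have "nrm (embedded j) (j x - j y) \<le> norm x + norm y" for x y
    using nrm_j[of "x - y"] by (simp add: diff norm_triangle_ineq4)
  moreover have "pts (embedded j) = range j"
    by (simp add: embedded_def)
  ultimately show ?thesis
    unfolding normed_subspace_def using sub M
    by (auto simp: nrm_j mult.commute)
qed

context
  fixes X :: "'e::real_normed_vector nspace"
  assumes X: "normed_subspace X"
begin

lemma nrm_nonneg: "x \<in> pts X \<Longrightarrow> 0 \<le> nrm X x"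
  and nrm_zero: "nrm X 0 = 0"
  and nrm_add: "x \<in> pts X \<Longrightarrow> y \<in> pts X \<Longrightarrow> nrm X (x + y) \<le> nrm X x + nrm X y"
  and nrm_diff: "x \<in> pts X \<Longrightarrow> y \<in> pts X \<Longrightarrow> nrm X (x - y) \<le> nrm X x + nrm X y"
  and pts_zero: "0 \<in> pts X"
  and pts_add: "x \<in> pts X \<Longrightarrow> y \<in> pts X \<Longrightarrow> x + y \<in> pts X"
  and pts_diff: "x \<in> pts X \<Longrightarrow> y \<in> pts X \<Longrightarrow> x - y \<in> pts X"
  using X by (auto simp: normed_subspace_def subspace_0 subspace_add subspace_diff)

lemma nrm_bound: "\<exists>M>0. \<forall>x\<in>pts X. norm x \<le> M * nrm X x"
  using X by (auto simp: normed_subspace_def)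

end

section \<open>The K-functional and its splittings\<close>

context
  fixes X Y :: "'e::real_normed_vector nspace"
  assumes X: "normed_subspace X" and Y: "normed_subspace Y"
begin

lemma K_functional_le:
  assumes "y \<in> pts X" "z \<in> pts Y" "0 < t"
  shows "K_functional X Y t (y + z) \<le> nrm X y + t * nrm Y z"
  unfolding K_functional_def
proof (rule cInf_lower)
  show "bdd_below {nrm X y' + t * nrm Y z' |y' z'. y' \<in> pts X \<and> z' \<in> pts Y \<and> y + z = y' + z'}"
    by (rule bdd_belowI[of _ 0]) (use \<open>0 < t\<close> nrm_nonneg[OF X] nrm_nonneg[OF Y] in auto)
qed (use assms in blast)

text \<open>The existence of one splitting keeps the infimum away from the empty set, where its
  value is unspecified.\<close>

lemma K_functional_greatest:
  assumes "\<exists>y\<in>pts X. \<exists>z\<in>pts Y. x = y + z"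
    and "\<And>y z. y \<in> pts X \<Longrightarrow> z \<in> pts Y \<Longrightarrow> x = y + z \<Longrightarrow> c \<le> nrm X y + t * nrm Y z"
  shows "c \<le> K_functional X Y t x"
  unfolding K_functional_def
  by (rule cInf_greatest) (use assms in auto)

lemma K_functional_nonneg:
  assumes "\<exists>y\<in>pts X. \<exists>z\<in>pts Y. x = y + z" "0 < t"
  shows "0 \<le> K_functional X Y t x"
  using assms nrm_nonneg[OF X] nrm_nonneg[OF Y] by (intro K_functional_greatest) auto

lemma K_functional_mono:
  assumes "\<exists>y\<in>pts X. \<exists>z\<in>pts Y. x = y + z" "0 < s" "s \<le> t"
  shows "K_functional X Y s x \<le> K_functional X Y t x"
proof (rule K_functional_greatest[OF assms(1)])
  fix y z assume yz: "y \<in> pts X" "z \<in> pts Y" "x = y + z"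
  have "K_functional X Y s x \<le> nrm X y + s * nrm Y z"
    using K_functional_le yz assms by blast
  also have "\<dots> \<le> nrm X y + t * nrm Y z"
    using assms nrm_nonneg[OF Y] yz by (simp add: mult_right_mono)
  finally show "K_functional X Y s x \<le> nrm X y + t * nrm Y z" .
qed

text \<open>The infimum need not be attained, but a factor 2 leaves room as soon as it is positive.
  Positivity for \<open>x \<noteq> 0\<close> comes from the continuous inclusions; for
  \<open>x = 0\<close> the splitting \<open>0 + 0\<close> costs nothing.\<close>

lemma K_functional_near_optimal:
  assumes x: "\<exists>y\<in>pts X. \<exists>z\<in>pts Y. x = y + z" and "0 < t"
  shows "\<exists>y\<in>pts X. \<exists>z\<in>pts Y. x = y + z \<and> nrm X y + t * nrm Y z \<le> 2 * K_functional X Y t x"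
proof (cases "x = 0")
  case True
  have "0 \<le> K_functional X Y t x"
    using K_functional_nonneg assms by blast
  then show ?thesis
    using True pts_zero[OF X] pts_zero[OF Y] nrm_zero[OF X] nrm_zero[OF Y]
    by (intro bexI[of _ 0]) auto
next
  case False
  obtain M where M: "M > 0" "\<And>x. x \<in> pts X \<Longrightarrow> norm x \<le> M * nrm X x"
    using nrm_bound[OF X] by blast
  obtain N where N: "N > 0" "\<And>x. x \<in> pts Y \<Longrightarrow> norm x \<le> N * nrm Y x"
    using nrm_bound[OF Y] by blast
  \<comment> \<open>\<open>R\<close> dominates both \<open>M\<close> and \<open>N / t\<close>, so
    \<open>norm x\<close> is at most \<open>R\<close> times the cost of any splitting.\<close>
  define R where "R = M + N / t"
  have "R > 0" using M N \<open>0 < t\<close> by (simp add: R_def add_pos_pos)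
  have "norm x / R \<le> K_functional X Y t x"
  proof (rule K_functional_greatest[OF x])
    fix y z assume yz: "y \<in> pts X" "z \<in> pts Y" "x = y + z"
    have "norm x \<le> M * nrm X y + N * nrm Y z"
      using yz M N norm_triangle_ineq[of y z] by fastforce
    also have "\<dots> = M * nrm X y + (N / t) * (t * nrm Y z)"
      using \<open>0 < t\<close> by simp
    also have "\<dots> \<le> R * nrm X y + R * (t * nrm Y z)"
      using M N \<open>0 < t\<close> nrm_nonneg[OF X yz(1)] nrm_nonneg[OF Y yz(2)]
      by (intro add_mono mult_right_mono) (auto simp: R_def)
    finally show "norm x / R \<le> nrm X y + t * nrm Y z"
      using \<open>R > 0\<close> by (simp add: divide_le_eq algebra_simps)
  qed
  then have "0 < K_functional X Y t x"
    using False \<open>R > 0\<close> by (smt (verit) divide_pos_pos zero_less_norm_iff)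
  \<comment> \<open>If every splitting cost at least twice the infimum, this double would be a lower
    bound and hence at most the infimum itself.\<close>
  then have "\<not> 2 * K_functional X Y t x \<le> K_functional X Y t x"
    by simp
  then show ?thesis
    using K_functional_greatest[OF x, of "2 * K_functional X Y t x" t] by (meson nle_le)
qed

end

section \<open>From pointwise bounds on K to interpolation norms\<close>

lemma interp_integral_le_cmult:
  assumes X: "normed_subspace X" and Y: "normed_subspace Y"
    and X': "normed_subspace X'" and Y': "normed_subspace Y'"
    and a: "\<exists>y\<in>pts X. \<exists>z\<in>pts Y. a = y + z"
    and b: "\<exists>y\<in>pts X'. \<exists>z\<in>pts Y'. b = y + z"
    and C: "0 \<le> C" and q: "0 \<le> q"
    and le: "\<And>t. 0 < t \<Longrightarrow> K_functional X Y t a \<le> C * K_functional X' Y' t b"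
  shows "interp_integral X Y \<theta> q a \<le> ennreal (C powr q) * interp_integral X' Y' \<theta> q b"
proof -
  \<comment> \<open>Extending K by zero to \<open>t \<le> 0\<close> makes it monotone on the whole
    line, hence Borel measurable, which is what pulling the constant out of the integral requires.
    The integral only sees \<open>t > 0\<close>.\<close>
  let ?g = "\<lambda>t. if t \<le> 0 then 0 else K_functional X' Y' t b"
  let ?G = "\<lambda>t. ennreal ((t powr (-\<theta>) * ?g t) powr q / t) * indicator {0<..} t"
  have "mono ?g"
    using K_functional_mono[OF X' Y' b] K_functional_nonneg[OF X' Y' b] by (intro monoI) auto
  then have g: "?g \<in> borel_measurable borel"
    by (rule borel_measurable_mono)
  have G: "?G \<in> borel_measurable lborel"
    using g by measurable
  have eq: "interp_integral X' Y' \<theta> q b = (\<integral>\<^sup>+t. ?G t \<partial>lborel)"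
    unfolding interp_integral_def by (intro nn_integral_cong) (auto simp: indicator_def)
  have "interp_integral X Y \<theta> q a \<le> (\<integral>\<^sup>+t. ennreal (C powr q) * ?G t \<partial>lborel)"
    unfolding interp_integral_def
  proof (rule nn_integral_mono)
    fix t :: real
    show "ennreal ((t powr (-\<theta>) * K_functional X Y t a) powr q / t) * indicator {0<..} t
        \<le> ennreal (C powr q) * ?G t"
    proof (cases "0 < t")
      case True
      have "(t powr (-\<theta>) * K_functional X Y t a) powr q
          \<le> (C * (t powr (-\<theta>) * K_functional X' Y' t b)) powr q"
        using le[OF True] K_functional_nonneg[OF X Y a True] q
        by (intro powr_mono2) (auto simp: mult.left_commute[of C] intro!: mult_left_mono)
      also have "\<dots> = C powr q * (t powr (-\<theta>) * K_functional X' Y' t b) powr q"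
        using C K_functional_nonneg[OF X' Y' b True] by (simp add: powr_mult)
      finally have "(t powr (-\<theta>) * K_functional X Y t a) powr q / t
          \<le> C powr q * ((t powr (-\<theta>) * K_functional X' Y' t b) powr q / t)"
        using True by (simp add: divide_right_mono)
      then show ?thesis
        using True by (simp add: ennreal_leI flip: ennreal_mult)
    qed simp
  qed
  also have "\<dots> = ennreal (C powr q) * interp_integral X' Y' \<theta> q b"
    unfolding eq by (rule nn_integral_cmult[OF G])
  finally show ?thesis .
qed

text \<open>One \<open>a\<close> has to serve all \<open>t\<close>, since a single element's
  K-functional is integrated. The constant survives unchanged because the q-th root of
  \<open>C powr q\<close> is \<open>C\<close>.\<close>

lemma image_embeds_real_interp:
  assumes A0: "normed_subspace A0" and A1: "normed_subspace A1"
    and B0: "normed_subspace B0" and B1: "normed_subspace B1"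
    and C: "0 < C" and q: "1 \<le> q"
    and K: "\<And>b. \<exists>y\<in>pts B0. \<exists>z\<in>pts B1. b = y + z \<Longrightarrow>
      \<exists>a. (\<exists>y\<in>pts A0. \<exists>z\<in>pts A1. a = y + z) \<and> S a = T b \<and>
        (\<forall>t>0. K_functional A0 A1 t a \<le> C * K_functional B0 B1 t b)"
  shows "image_embeds T (real_interp B0 B1 \<theta> q) S (real_interp A0 A1 \<theta> q)"
  unfolding image_embeds_def
proof (intro exI[of _ C] conjI ballI C)
  fix b assume "b \<in> pts (real_interp B0 B1 \<theta> q)"
  then have b: "\<exists>y\<in>pts B0. \<exists>z\<in>pts B1. b = y + z"
    and fin: "interp_integral B0 B1 \<theta> q b < \<infinity>"
    by (auto simp: real_interp_def)
  obtain a where a: "\<exists>y\<in>pts A0. \<exists>z\<in>pts A1. a = y + z" "S a = T b"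
    and Ka: "\<And>t. 0 < t \<Longrightarrow> K_functional A0 A1 t a \<le> C * K_functional B0 B1 t b"
    using K[OF b] by blast
  have le: "interp_integral A0 A1 \<theta> q a \<le> ennreal (C powr q) * interp_integral B0 B1 \<theta> q b"
    using interp_integral_le_cmult[OF A0 A1 B0 B1 a(1) b] C q Ka by simp
  \<comment> \<open>Since \<open>enn2real\<close> sends infinity to 0, it preserves the inequality
    only below a finite bound.\<close>
  have fin': "ennreal (C powr q) * interp_integral B0 B1 \<theta> q b < \<infinity>"
    using fin by (simp add: ennreal_mult_less_top)
  have "nrm (real_interp A0 A1 \<theta> q) a
      \<le> enn2real (ennreal (C powr q) * interp_integral B0 B1 \<theta> q b) powr (1 / q)"
    using enn2real_mono[OF le] fin' q by (auto simp: real_interp_def intro!: powr_mono2)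
  also have "\<dots> = C * nrm (real_interp B0 B1 \<theta> q) b"
    using C q by (simp add: real_interp_def enn2real_mult powr_mult powr_powr)
  finally have "nrm (real_interp A0 A1 \<theta> q) a \<le> C * nrm (real_interp B0 B1 \<theta> q) b" .
  moreover have "a \<in> pts (real_interp A0 A1 \<theta> q)"
    using a le_less_trans[OF le fin'] by (simp add: real_interp_def)
  ultimately show "\<exists>a\<in>pts (real_interp A0 A1 \<theta> q). S a = T b \<and>
      nrm (real_interp A0 A1 \<theta> q) a \<le> C * nrm (real_interp B0 B1 \<theta> q) b"
    using a by blast
qed

section \<open>Lifting an element with control of K for all \<open>t\<close>\<close>

lemma K_functional_lift:
  fixes A0 A1 B0 B1 :: "'e::real_normed_vector nspace"
  assumes A0: "normed_subspace A0" and A1: "normed_subspace A1"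
    and B0: "normed_subspace B0" and B1: "normed_subspace B1"
    and "linear T"
    and "A1 \<hookrightarrow> A0" "B0 \<hookrightarrow> A0" "inter_space A0 B1 \<hookrightarrow> A1" "image_embeds T B1 T A1"
  shows "\<exists>C>0. \<forall>b. (\<exists>y\<in>pts B0. \<exists>z\<in>pts B1. b = y + z) \<longrightarrow>
      (\<exists>a. (\<exists>y\<in>pts A0. \<exists>z\<in>pts A1. a = y + z) \<and> T a = T b \<and>
        (\<forall>t>0. K_functional A0 A1 t a \<le> C * K_functional B0 B1 t b))"
proof -
  obtain c1 where c1: "c1 > 0" "\<And>x. x \<in> pts A1 \<Longrightarrow> x \<in> pts A0 \<and> nrm A0 x \<le> c1 * nrm A1 x"
    using \<open>A1 \<hookrightarrow> A0\<close> by (auto simp: embeds_def)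
  obtain c2 where c2: "c2 > 0" "\<And>x. x \<in> pts B0 \<Longrightarrow> x \<in> pts A0 \<and> nrm A0 x \<le> c2 * nrm B0 x"
    using \<open>B0 \<hookrightarrow> A0\<close> by (auto simp: embeds_def)
  obtain c3 where c3: "c3 > 0" "\<And>x. x \<in> pts A0 \<Longrightarrow> x \<in> pts B1 \<Longrightarrow>
      x \<in> pts A1 \<and> nrm A1 x \<le> c3 * max (nrm A0 x) (nrm B1 x)"
    using \<open>inter_space A0 B1 \<hookrightarrow> A1\<close> by (auto simp: embeds_def inter_space_def)
  obtain c4 where c4: "c4 > 0" "\<And>z. z \<in> pts B1 \<Longrightarrow> \<exists>a\<in>pts A1. T a = T z \<and> nrm A1 a \<le> c4 * nrm B1 z"
    using \<open>image_embeds T B1 T A1\<close> by (auto simp: image_embeds_def)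
  \<comment> \<open>\<open>c2 + 1\<close> dominates both \<open>c2\<close> and 1, so it covers the
    \<open>A0\<close> norm and the \<open>B1\<close> norm of the difference \<open>w\<close> below.
    \<open>C1\<close> will serve \<open>t \<ge> 1\<close> and \<open>C2\<close> will serve
    \<open>t < 1\<close>.\<close>
  define c5 where "c5 = c3 * (c2 + 1)"
  define C1 where "C1 = 2 * (c2 + c1 * c4)"
  define C2 where "C2 = c2 + 3 * c5 + 2 * c4"
  have c5: "c5 > 0" using c2 c3 by (simp add: c5_def)
  have pos: "C1 > 0" "C2 > 0" using c1 c2 c4 c5 by (simp_all add: C1_def C2_def add_pos_pos)
  show ?thesis
  proof (intro exI[of _ "C1 + C2"] conjI allI impI)
    show "0 < C1 + C2" using pos by simp
  next
    fix b assume b: "\<exists>y\<in>pts B0. \<exists>z\<in>pts B1. b = y + z"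
    define k where "k = K_functional B0 B1 1 b"
    obtain y1 z1 where y1: "y1 \<in> pts B0" and z1: "z1 \<in> pts B1" and b1: "b = y1 + z1"
      and opt: "nrm B0 y1 + nrm B1 z1 \<le> 2 * k"
      using K_functional_near_optimal[OF B0 B1 b, of 1] by (auto simp: k_def)
    obtain a1 where a1: "a1 \<in> pts A1" "T a1 = T z1" "nrm A1 a1 \<le> c4 * nrm B1 z1"
      using c4(2)[OF z1] by blast
    note y1_nonneg = nrm_nonneg[OF B0 y1] and z1_nonneg = nrm_nonneg[OF B1 z1]
    have a1_le: "nrm A1 a1 \<le> c4 * (2 * k)"
      using a1(3) opt y1_nonneg c4(1) by (smt (verit) mult_left_mono)
    let ?a = "y1 + a1"
    have a_A0: "?a \<in> pts A0"
      using c1(2)[OF a1(1)] c2(2)[OF y1] pts_add[OF A0] by blast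
    have "nrm A0 ?a \<le> nrm A0 y1 + nrm A0 a1"
      using c1(2)[OF a1(1)] c2(2)[OF y1] nrm_add[OF A0] by blast
    also have "\<dots> \<le> c2 * (2 * k) + c1 * (c4 * (2 * k))"
    proof (rule add_mono)
      show "nrm A0 y1 \<le> c2 * (2 * k)"
        using c2(2)[OF y1] opt z1_nonneg c2(1) by (smt (verit) mult_left_mono)
      show "nrm A0 a1 \<le> c1 * (c4 * (2 * k))"
        using c1(2)[OF a1(1)] a1_le c1(1) by (smt (verit) mult_left_mono)
    qed
    finally have a_le: "nrm A0 ?a \<le> C1 * k"
      by (simp add: C1_def algebra_simps)
    have K: "K_functional A0 A1 t ?a \<le> (C1 + C2) * K_functional B0 B1 t b" if t: "0 < t" for t
    proof (cases "1 \<le> t")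
      case True
      have "K_functional A0 A1 t (?a + 0) \<le> nrm A0 ?a + t * nrm A1 0"
        using K_functional_le[OF A0 A1 a_A0 pts_zero[OF A1] t] .
      also have "\<dots> \<le> C1 * k"
        using a_le by (simp add: nrm_zero[OF A1])
      also have "\<dots> \<le> C1 * K_functional B0 B1 t b"
        using K_functional_mono[OF B0 B1 b _ True] pos by (simp add: k_def)
      also have "\<dots> \<le> (C1 + C2) * K_functional B0 B1 t b"
        using pos K_functional_nonneg[OF B0 B1 b t] by (simp add: mult_right_mono)
      finally show ?thesis by simp
    next
      case False
      \<comment> \<open>Dividing by \<open>C2\<close> turns the claim into a lower bound for the
        cost \<open>D\<close> of each splitting of \<open>b\<close>.\<close>
      have "K_functional A0 A1 t ?a / C2 \<le> K_functional B0 B1 t b"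
      proof (rule K_functional_greatest[OF B0 B1 b])
        fix y z assume y: "y \<in> pts B0" and z: "z \<in> pts B1" and yz: "b = y + z"
        note y_nonneg = nrm_nonneg[OF B0 y] and z_nonneg = nrm_nonneg[OF B1 z]
        define D where "D = nrm B0 y + t * nrm B1 z"
        \<comment> \<open>This form puts \<open>w\<close> in \<open>A0\<close> through
          \<open>B0\<close>; the form \<open>z - z1\<close> puts it in \<open>B1\<close>.\<close>
        define w where "w = y1 - y"
        have w: "w = z - z1"
          using yz b1 unfolding w_def by (metis add.commute add_diff_eq diff_add_cancel diff_eq_eq)
        have w_A0: "w \<in> pts A0"
          unfolding w_def using c2(2)[OF y] c2(2)[OF y1] pts_diff[OF A0] by blast
        have w_B1: "w \<in> pts B1"
          unfolding w using z z1 pts_diff[OF B1] by blast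
        \<comment> \<open>The bound \<open>t * K(1,b) <= K(t,b)\<close> for \<open>t < 1\<close>, at
          the level of one splitting: \<open>t\<close> times its cost at 1 is at most
          \<open>D\<close>.\<close>
        have "nrm B0 y + nrm B1 z \<ge> k"
          using K_functional_le[OF B0 B1 y z, of 1] yz by (simp add: k_def)
        then have "t * k \<le> t * (nrm B0 y + nrm B1 z)"
          using t by simp
        moreover have ty: "t * nrm B0 y \<le> nrm B0 y"
          using y_nonneg False t by (simp add: mult_left_le_one_le)
        ultimately have tk: "t * k \<le> D" and tyz: "t * (nrm B0 y + nrm B1 z) \<le> D"
          by (simp_all add: D_def algebra_simps)
        \<comment> \<open>Both norms of \<open>w\<close> are widened to one bound in all four norms,
          which replaces the maximum; near-optimality then bounds the pair \<open>y1\<close>,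
          \<open>z1\<close> by \<open>2 * k\<close>.\<close>
        have "nrm A0 w \<le> nrm A0 y1 + nrm A0 y"
          unfolding w_def using c2(2)[OF y] c2(2)[OF y1] nrm_diff[OF A0] by blast
        also have "\<dots> \<le> c2 * (nrm B0 y1 + nrm B0 y)"
          using c2(2)[OF y] c2(2)[OF y1] by (simp add: distrib_left add_mono)
        also have "\<dots> \<le> (c2 + 1) * (nrm B0 y1 + nrm B1 z1 + (nrm B0 y + nrm B1 z))"
          using c2(1) y1_nonneg z1_nonneg y_nonneg z_nonneg by (intro mult_mono) auto
        finally have wA0: "nrm A0 w \<le> \<dots>" .
        have "nrm B1 w \<le> 1 * (nrm B1 z + nrm B1 z1)"
          unfolding w using nrm_diff[OF B1 z z1] by simp
        also have "\<dots> \<le> (c2 + 1) * (nrm B0 y1 + nrm B1 z1 + (nrm B0 y + nrm B1 z))"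
          using c2(1) y1_nonneg z1_nonneg y_nonneg z_nonneg by (intro mult_mono) auto
        finally have wB1: "nrm B1 w \<le> \<dots>" .
        have "nrm A1 w \<le> c3 * max (nrm A0 w) (nrm B1 w)"
          using c3(2)[OF w_A0 w_B1] by blast
        also have "\<dots> \<le> c3 * ((c2 + 1) * (nrm B0 y1 + nrm B1 z1 + (nrm B0 y + nrm B1 z)))"
          using wA0 wB1 c3(1) by simp
        also have "\<dots> = c5 * (nrm B0 y1 + nrm B1 z1 + (nrm B0 y + nrm B1 z))"
          by (simp add: c5_def)
        also have "\<dots> \<le> c5 * (2 * k + (nrm B0 y + nrm B1 z))"
          using opt c5 by simp
        finally have w_le: "nrm A1 w \<le> \<dots>" .
        have wa: "w + a1 \<in> pts A1" and "nrm A1 (w + a1) \<le> nrm A1 w + nrm A1 a1"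
          using c3(2)[OF w_A0 w_B1] a1(1) pts_add[OF A1] nrm_add[OF A1] by blast+
        then have "nrm A1 (w + a1) \<le> c5 * (2 * k + (nrm B0 y + nrm B1 z)) + c4 * (2 * k)"
          using w_le a1_le by linarith
        \<comment> \<open>After multiplication by \<open>t\<close> each term is at most a multiple
          of \<open>D\<close>: \<open>2 * c5\<close> and \<open>2 * c4\<close> from
          \<open>t * k\<close>, and \<open>c5\<close> from the cost of \<open>y\<close>,
          \<open>z\<close> at 1. With \<open>c2\<close> from \<open>nrm A0 y\<close> these add up to
          \<open>C2\<close>.\<close>
        then have "t * nrm A1 (w + a1) \<le> t * (c5 * (2 * k + (nrm B0 y + nrm B1 z)) + c4 * (2 * k))"
          using t by simp
        also have "\<dots> = 2 * c5 * (t * k) + c5 * (t * (nrm B0 y + nrm B1 z)) + 2 * c4 * (t * k)"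
          by (simp add: algebra_simps)
        also have "\<dots> \<le> 2 * c5 * D + c5 * D + 2 * c4 * D"
          using tk tyz c5 c4(1) by (intro add_mono mult_left_mono) auto
        finally have tw: "t * nrm A1 (w + a1) \<le> \<dots>" .
        have y_le: "nrm A0 y \<le> c2 * D"
          using c2 y_nonneg z_nonneg t unfolding D_def
          by (smt (verit) mult_left_mono mult_nonneg_nonneg y)
        have "?a = y + (w + a1)"
          by (simp add: w_def)
        then have "K_functional A0 A1 t ?a \<le> nrm A0 y + t * nrm A1 (w + a1)"
          using K_functional_le[OF A0 A1 _ wa t, of y] c2(2)[OF y] by metis
        also have "\<dots> \<le> C2 * D"
          using tw y_le by (simp add: C2_def algebra_simps)
        finally show "K_functional A0 A1 t ?a / C2 \<le> nrm B0 y + t * nrm B1 z"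
          using pos by (simp add: D_def divide_le_eq mult.commute)
      qed
      then have "K_functional A0 A1 t ?a \<le> C2 * K_functional B0 B1 t b"
        using pos by (simp add: divide_le_eq mult.commute)
      also have "\<dots> \<le> (C1 + C2) * K_functional B0 B1 t b"
        using pos K_functional_nonneg[OF B0 B1 b t] by (simp add: mult_right_mono)
      finally show ?thesis .
    qed
    have "T ?a = T b"
      using a1(2) b1 linear_add[OF \<open>linear T\<close>] by simp
    moreover have "\<exists>y\<in>pts A0. \<exists>z\<in>pts A1. ?a = y + z"
      using c2(2)[OF y1] a1(1) by blast
    ultimately show "\<exists>a. (\<exists>y\<in>pts A0. \<exists>z\<in>pts A1. a = y + z) \<and> T a = T b \<and>
        (\<forall>t>0. K_functional A0 A1 t a \<le> (C1 + C2) * K_functional B0 B1 t b)"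
      using K by blast
  qed
qed

theorem theorem9:
  fixes jA0 :: "'a0::banach \<Rightarrow> 'e::banach"
    and jA1 :: "'a1::banach \<Rightarrow> 'e"
    and jB0 :: "'b0::banach \<Rightarrow> 'e"
    and jB1 :: "'b1::banach \<Rightarrow> 'e"
    and T :: "'e \<Rightarrow> 'f::banach"
    and \<theta> q :: real
  defines "A0 \<equiv> embedded jA0"
    and "A1 \<equiv> embedded jA1"
    and "B0 \<equiv> embedded jB0"
    and "B1 \<equiv> embedded jB1"
  assumes "nontrivial_space TYPE('a0)" "nontrivial_space TYPE('a1)"
    and "nontrivial_space TYPE('b0)" "nontrivial_space TYPE('b1)"
    and "nontrivial_space TYPE('e)" "nontrivial_space TYPE('f)"
    and "continuous_embedding jA0" "continuous_embedding jA1"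
    and "continuous_embedding jB0" "continuous_embedding jB1"
    and "bounded_linear T"
    and "is_predual TYPE('p0::banach) TYPE('a0)" "separable TYPE('p0)"
    and "is_predual TYPE('p1::banach) TYPE('a1)" "separable TYPE('p1)"
    and "separable TYPE('e)" "reflexive TYPE('e)"
    and "A1 \<hookrightarrow> A0" "B0 \<hookrightarrow> A0" "inter_space A0 B1 \<hookrightarrow> A1"
    and "image_embeds T B1 T A1"
    and "0 < \<theta>" "\<theta> < 1" "1 \<le> q"
  shows "image_embeds T (real_interp B0 B1 \<theta> q) T (real_interp A0 A1 \<theta> q)"
proof -
  have A0: "normed_subspace A0" and A1: "normed_subspace A1"
    and B0: "normed_subspace B0" and B1: "normed_subspace B1"
    unfolding A0_def A1_def B0_def B1_def
    by (intro normed_subspace_embedded; fact)+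
  have "linear T"
    using \<open>bounded_linear T\<close> by (rule bounded_linear.linear)
  from K_functional_lift[OF A0 A1 B0 B1 this \<open>A1 \<hookrightarrow> A0\<close> \<open>B0 \<hookrightarrow> A0\<close>
      \<open>inter_space A0 B1 \<hookrightarrow> A1\<close> \<open>image_embeds T B1 T A1\<close>]
  show ?thesis
    using image_embeds_real_interp[OF A0 A1 B0 B1 _ \<open>1 \<le> q\<close>, of _ T T \<theta>] by blast
qed

end
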